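(* Let $k$ be a positive integer. A binary function is $k$-polymatroidal if and only if it has no minor isomorphic to any of: (i) $f_\alpha$, where $\alpha\in\mathbb{R}\setminus\{2^n-1 : n\in\{0,1,\dots,k\}\}$ (i.e. $\alpha\notin\{0,1,3,\ldots,2^k-1\}$); (ii) $f_{\alpha,\beta,\gamma}\colon 2^{\{a,b\}}\to\mathbb{R}$, where $\alpha,\beta,\gamma$ are integers with $0\leq\alpha\leq\beta\leq\gamma\leq k-1$ and $f_{\alpha,\beta,\gamma}(\emptyset)=1$, $f_{\alpha,\beta,\gamma}(\{a\})=2^{\alpha+\gamma-\beta+1}-1$, $f_{\alpha,\beta,\gamma}(\{b\})=2^{\gamma+1}-1$, $f_{\alpha,\beta,\gamma}(\{a,b\})=2^{\alpha+\gamma+1}-2^{\gamma+1}-2^{\alpha+\gamma-\beta+1}+1$.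
   Context: A binary function on a finite ground set $E$ is a function $f\colon 2^E\to\mathbb{R}$ with $f(\emptyset)=1$. Its rank function $Qf\colon 2^E\to\mathbb{R}$ is $Qf(X)=\log_2\left(\frac{\sum_{Y\subseteq E} f(Y)}{\sum_{Y\subseteq E\setminus X} f(Y)}\right)$; $f$ is rankable if $Qf(X)$ is well defined for every $X\subseteq E$. For a positive integer $k$, $f$ is $k$-polymatroidal if $f$ is rankable and $Qf$ satisfies: (R0) $Qf(X)$ is a nonnegative integer for all $X\subseteq E$; (R1) $Qf(X)\leq k|X|$ for all $X\subseteq E$; (R2) $Qf(X)\leq Qf(X\cup\{e\})$ for all $X\subseteq E$, $e\in E\setminus X$; (R3) $Qf(X)+Qf(X\cup\{a,b\})\leq Qf(X\cup\{a\})+Qf(X\cup\{b\})$ for all $X\subseteq E$ and distinct $a,b\in E\setminus X$. For $X\subseteq E$, the contraction $f/X\colon 2^{E\setminus X}\to\mathbb{R}$ is $f/X(Y)=f(Y)$, and the deletion $f\setminus X\colon 2^{E\setminus X}\to\mathbb{R}$ is $f\setminus X(Y)=\frac{\sum_{Z\subseteq X} f(Y\cup Z)}{\sum_{Z\subseteq X} f(Z)}$, well defined exactly when the denominator is nonzero. A minor of $f$ is a well-defined binary function $(f/X)\setminus Y$ for disjoint $X,Y\subseteq E$. Two binary functions $f$ on $E$ and $f'$ on $E'$ are isomorphic if there is a bijection $\phi\colon E\to E'$ with $f(X)=f'(\phi(X))$ for all $X\subseteq E$. For $\alpha\in\mathbb{R}$, $f_\alpha$ denotes the binary function on a one-element ground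 set $E$ with $f_\alpha(E)=\alpha$. *)

theory Defs
  imports Complex_Main
begin

text \<open>
  A function on the power set of a ground set. Only the values on subsets of the ground set
  are meaningful; no notion below looks at any other value.
\<close>
record 'a setfun =
  ground :: "'a set"
  val :: "'a set \<Rightarrow> real"

definition binary_function :: "'a setfun \<Rightarrow> bool" where
  "binary_function f \<longleftrightarrow> finite (ground f) \<and> val f {} = 1"

definition rank_quotient :: "'a setfun \<Rightarrow> 'a set \<Rightarrow> real" where
  "rank_quotient f X =
     (\<Sum>Y\<in>Pow (ground f). val f Y) / (\<Sum>Y\<in>Pow (ground f - X). val f Y)"

definition Q :: "'a setfun \<Rightarrow> 'a set \<Rightarrow> real" where
  "Q f X = log 2 (rank_quotient f X)"

text \<open>
  Well-definedness of the rank has to be stated explicitly, since division and logarithm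
  are total functions in HOL.
\<close>
definition rankable :: "'a setfun \<Rightarrow> bool" where
  "rankable f \<longleftrightarrow>
     (\<forall>X\<subseteq>ground f. (\<Sum>Y\<in>Pow (ground f - X). val f Y) \<noteq> 0 \<and> rank_quotient f X > 0)"

definition polymatroidal :: "nat \<Rightarrow> 'a setfun \<Rightarrow> bool" where
  "polymatroidal k f \<longleftrightarrow> rankable f \<and>
     (\<forall>X\<subseteq>ground f. Q f X \<in> \<nat>) \<and>
     (\<forall>X\<subseteq>ground f. Q f X \<le> real k * real (card X)) \<and>
     (\<forall>X\<subseteq>ground f. \<forall>e\<in>ground f - X. Q f X \<le> Q f (X \<union> {e})) \<and>
     (\<forall>X\<subseteq>ground f. \<forall>a\<in>ground f - X. \<forall>b\<in>ground f - X. a \<noteq> b \<longrightarrow>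
        Q f X + Q f (X \<union> {a, b}) \<le> Q f (X \<union> {a}) + Q f (X \<union> {b}))"

definition contraction :: "'a setfun \<Rightarrow> 'a set \<Rightarrow> 'a setfun" where
  "contraction f X = \<lparr>ground = ground f - X, val = val f\<rparr>"

definition deletion :: "'a setfun \<Rightarrow> 'a set \<Rightarrow> 'a setfun" where
  "deletion f X =
     \<lparr>ground = ground f - X,
      val = (\<lambda>Y. (\<Sum>Z\<in>Pow X. val f (Y \<union> Z)) / (\<Sum>Z\<in>Pow X. val f Z))\<rparr>"

definition deletion_defined :: "'a setfun \<Rightarrow> 'a set \<Rightarrow> bool" where
  "deletion_defined f X \<longleftrightarrow> (\<Sum>Z\<in>Pow X. val f Z) \<noteq> 0"

definition is_minor :: "'a setfun \<Rightarrow> 'a setfun \<Rightarrow> bool" where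
  "is_minor g f \<longleftrightarrow>
     (\<exists>X Y. X \<subseteq> ground f \<and> Y \<subseteq> ground f \<and> X \<inter> Y = {} \<and>
        deletion_defined (contraction f X) Y \<and> g = deletion (contraction f X) Y)"

definition isomorphic :: "'a setfun \<Rightarrow> 'b setfun \<Rightarrow> bool" where
  "isomorphic f g \<longleftrightarrow>
     (\<exists>\<phi>. bij_betw \<phi> (ground f) (ground g) \<and> (\<forall>X\<subseteq>ground f. val f X = val g (\<phi> ` X)))"

definition f1 :: "real \<Rightarrow> unit setfun" where
  "f1 \<alpha> = \<lparr>ground = UNIV, val = (\<lambda>X. if X = {} then 1 else \<alpha>)\<rparr>"

datatype two_points = pt_a | pt_b

text \<open>Used only for \<open>\<alpha> \<le> \<beta> \<le> \<gamma>\<close>, so the subtraction in the exponents never truncates.\<close>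
definition f3 :: "nat \<Rightarrow> nat \<Rightarrow> nat \<Rightarrow> two_points setfun" where
  "f3 \<alpha> \<beta> \<gamma> =
     \<lparr>ground = {pt_a, pt_b},
      val = (\<lambda>X.
        if X = {} then 1
        else if X = {pt_a} then 2 ^ (\<alpha> + \<gamma> - \<beta> + 1) - 1
        else if X = {pt_b} then 2 ^ (\<gamma> + 1) - 1
        else 2 ^ (\<alpha> + \<gamma> + 1) - 2 ^ (\<gamma> + 1) - 2 ^ (\<alpha> + \<gamma> - \<beta> + 1) + 1)\<rparr>"

end

theory Submission
  imports Defs
begin

text \<open>
  Write \<open>S A\<close> for the sum of \<open>f\<close> over the subsets of \<open>A\<close>, so that
  \<open>Q f X = log 2 (S E / S (E - X))\<close>. The minor of \<open>f\<close> on a set \<open>G\<close> obtained by deleting \<open>Y\<close>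
  (and contracting the rest) has subset sums \<open>S (T \<union> Y) / S Y\<close> for \<open>T \<subseteq> G\<close>. Hence the
  one-element minors record the ratios \<open>S (Y \<union> {e}) / S Y\<close>: as \<open>S {} = 1\<close>, excluding (i) says
  precisely that \<open>S A = 2 ^ r A\<close> for a function \<open>r\<close> whose increments lie in \<open>{0..k}\<close>. Given this,
  the minors in (ii) are the two-element minors at which \<open>r\<close> fails to be supermodular, and
  supermodularity of \<open>r\<close> is submodularity of \<open>Q f X = r E - r (E - X)\<close>.
\<close>

section \<open>Subset sums and their binary exponents\<close>

definition subset_sum :: "'a setfun \<Rightarrow> 'a set \<Rightarrow> real" where
  "subset_sum f A = (\<Sum>Y\<in>Pow A. val f Y)"

text \<open>Taking \<open>r\<close> with natural values, in place of a real logarithm of the sum,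
  builds integrality of the exponents and positivity of the sums into the notion. On subsets of the
  ground set \<open>r\<close> is unique, since powers of two determine their exponent; elsewhere its
  values are arbitrary.\<close>

definition exponent_function :: "nat \<Rightarrow> 'a setfun \<Rightarrow> ('a set \<Rightarrow> nat) \<Rightarrow> bool" where
  "exponent_function k f r \<longleftrightarrow>
     (\<forall>A\<subseteq>ground f. subset_sum f A = 2 ^ r A) \<and>
     (\<forall>A e. insert e A \<subseteq> ground f \<longrightarrow> e \<notin> A \<longrightarrow> r A \<le> r (insert e A) \<and> r (insert e A) \<le> r A + k)"

text \<open>This is the shape that (R3) takes under complementation, with \<open>A\<close> the
  complement of \<open>X \<union> {a, b}\<close>; hence only one-element and two-element extensions
  occur.\<close>

definition locally_supermodular :: "'a set \<Rightarrow> ('a set \<Rightarrow> nat) \<Rightarrow> bool" where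
  "locally_supermodular E r \<longleftrightarrow>
     (\<forall>A a b. insert a (insert b A) \<subseteq> E \<longrightarrow> a \<notin> A \<longrightarrow> b \<notin> A \<longrightarrow> a \<noteq> b \<longrightarrow>
        r (insert a A) + r (insert b A) \<le> r A + r (insert a (insert b A)))"

section \<open>Minors in terms of subset sums\<close>

lemma sum_Pow_insert:
  fixes h :: "'a set \<Rightarrow> 'b::comm_monoid_add"
  assumes "finite A" "e \<notin> A"
  shows "sum h (Pow (insert e A)) = sum h (Pow A) + (\<Sum>Z\<in>Pow A. h (insert e Z))"
proof -
  have "inj_on (insert e) (Pow A)"
    using assms(2) by (auto simp: inj_on_def)
  moreover have "Pow A \<inter> insert e ` Pow A = {}"
    using assms(2) by auto
  ultimately show ?thesis
    using assms(1) by (simp add: Pow_insert sum.union_disjoint sum.reindex)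
qed

lemma subset_sum_empty: "binary_function f \<Longrightarrow> subset_sum f {} = 1"
  by (simp add: subset_sum_def binary_function_def)

text \<open>Contraction keeps the values, and deleting \<open>Y\<close> divides the sum of
  \<open>val f (W \<union> Z)\<close> over \<open>Z \<subseteq> Y\<close> by
  \<open>subset_sum f Y\<close>. Inclusion-exclusion over \<open>W\<close> expresses that numerator
  by subset sums; the terms \<open>- 1\<close> and \<open>+ 1\<close> are
  \<open>subset_sum f Y\<close> divided by itself.\<close>

lemma val_minor:
  fixes f :: "'a setfun" and X Y :: "'a set"
  assumes "binary_function f" "Y \<subseteq> ground f"
    and S: "subset_sum f Y \<noteq> 0"
  defines "g \<equiv> deletion (contraction f X) Y"
  shows val_minor_empty: "val g {} = 1"
    and val_minor_singleton:
      "a \<notin> Y \<Longrightarrow> val g {a} = subset_sum f (insert a Y) / subset_sum f Y - 1"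
    and val_minor_pair:
      "a \<notin> Y \<Longrightarrow> b \<notin> Y \<Longrightarrow> a \<noteq> b \<Longrightarrow>
        val g {a, b} = (subset_sum f (insert a (insert b Y)) - subset_sum f (insert a Y)
          - subset_sum f (insert b Y)) / subset_sum f Y + 1"
proof -
  have fin: "finite Y"
    using assms(1,2) by (auto simp: binary_function_def intro: finite_subset)
  have val_g: "val g W = (\<Sum>Z\<in>Pow Y. val f (W \<union> Z)) / subset_sum f Y" for W
    by (simp add: g_def deletion_def contraction_def subset_sum_def)
  show "val g {} = 1"
    using S by (simp add: val_g) (simp add: subset_sum_def)
  have single: "(\<Sum>Z\<in>Pow Y. val f (insert a Z)) = subset_sum f (insert a Y) - subset_sum f Y"
    if "a \<notin> Y" for a
    using fin that by (simp add: subset_sum_def sum_Pow_insert)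
  show "val g {a} = subset_sum f (insert a Y) / subset_sum f Y - 1" if "a \<notin> Y"
    using S that by (simp add: val_g single diff_divide_distrib)
  show "val g {a, b} = (subset_sum f (insert a (insert b Y)) - subset_sum f (insert a Y)
          - subset_sum f (insert b Y)) / subset_sum f Y + 1"
    if "a \<notin> Y" "b \<notin> Y" "a \<noteq> b"
  proof -
    \<comment> \<open>The sets are split by \<open>a\<close> first, and those containing
      \<open>a\<close> are then split by \<open>b\<close>.\<close>
    have "subset_sum f (insert a (insert b Y)) = subset_sum f (insert b Y)
        + ((\<Sum>Z\<in>Pow Y. val f (insert a Z)) + (\<Sum>Z\<in>Pow Y. val f (insert a (insert b Z))))"
      unfolding subset_sum_def using fin that by (simp add: sum_Pow_insert)
    then have "(\<Sum>Z\<in>Pow Y. val f (insert a (insert b Z))) =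
        subset_sum f (insert a (insert b Y)) - subset_sum f (insert a Y)
          - subset_sum f (insert b Y) + subset_sum f Y"
      using single[OF that(1)] by simp
    then show ?thesis
      using S by (simp add: val_g add_divide_distrib)
  qed
qed

text \<open>A minor is determined by its ground set \<open>G\<close> and the deleted set
  \<open>Y\<close>, the contracted set being the rest. Looking for a minor on one or two elements
  thus becomes a choice of \<open>G\<close> of that size; \<open>P\<close> will be isomorphism with
  an excluded function.\<close>

lemma ex_minor_iff:
  "(\<exists>g. is_minor g f \<and> P g) \<longleftrightarrow>
    (\<exists>G Y. G \<subseteq> ground f \<and> Y \<subseteq> ground f \<and> G \<inter> Y = {} \<and> subset_sum f Y \<noteq> 0 \<and>
      P (deletion (contraction f (ground f - G - Y)) Y))"
  (is "?L \<longleftrightarrow> ?R")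
proof
  assume ?L
  then obtain X Y where XY: "X \<subseteq> ground f" "Y \<subseteq> ground f" "X \<inter> Y = {}"
      "deletion_defined (contraction f X) Y" "P (deletion (contraction f X) Y)"
    by (auto simp: is_minor_def)
  have "ground f - (ground f - X - Y) - Y = X"
    using XY by blast
  moreover have "ground f - X - Y \<subseteq> ground f" "(ground f - X - Y) \<inter> Y = {}"
    by blast+
  moreover have "subset_sum f Y \<noteq> 0"
    using XY(4) by (simp add: deletion_defined_def contraction_def subset_sum_def)
  ultimately show ?R
    using XY(2,5) by metis
next
  assume ?R
  then obtain G Y where "G \<subseteq> ground f" "Y \<subseteq> ground f" "G \<inter> Y = {}" "subset_sum f Y \<noteq> 0"
      "P (deletion (contraction f (ground f - G - Y)) Y)"
    by blast
  moreover from this have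
      "is_minor (deletion (contraction f (ground f - G - Y)) Y) f"
    unfolding is_minor_def deletion_defined_def
    by (intro exI[of _ "ground f - G - Y", OF exI[of _ Y]])
      (auto simp: contraction_def subset_sum_def)
  ultimately show ?L
    by blast
qed

lemma ground_minor:
  assumes "G \<subseteq> ground f" "G \<inter> Y = {}"
  shows "ground (deletion (contraction f (ground f - G - Y)) Y) = G"
  using assms by (auto simp: deletion_def contraction_def)

lemma isomorphic_f1_iff:
  "isomorphic g (f1 \<alpha>) \<longleftrightarrow> (\<exists>e. ground g = {e} \<and> val g {} = 1 \<and> val g {e} = \<alpha>)"
  (is "?L \<longleftrightarrow> ?R")
proof
  assume ?L
  then obtain \<phi> where \<phi>: "bij_betw \<phi> (ground g) (UNIV :: unit set)"
      "\<And>X. X \<subseteq> ground g \<Longrightarrow> val g X = (if \<phi> ` X = {} then 1 else \<alpha>)"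
    by (auto simp: isomorphic_def f1_def)
  have "card (ground g) = 1"
    using bij_betw_same_card[OF \<phi>(1)] by simp
  then obtain e where "ground g = {e}"
    by (auto simp: card_1_singleton_iff)
  then show ?R
    using \<phi>(2)[of "{}"] \<phi>(2)[of "{e}"] by auto
next
  assume ?R
  then obtain e where "ground g = {e}" "val g {} = 1" "val g {e} = \<alpha>"
    by blast
  then show ?L
    by (auto simp: isomorphic_def f1_def bij_betw_def subset_singleton_iff
        intro!: exI[of _ "\<lambda>_. ()"])
qed

text \<open>The bijection is traded for names \<open>a\<close> and \<open>b\<close> of the preimages
  of the two points, which leaves four values to compare.\<close>

lemma isomorphic_f3_iff:
  "isomorphic g (f3 \<alpha> \<beta> \<gamma>) \<longleftrightarrow>
    (\<exists>a b. a \<noteq> b \<and> ground g = {a, b} \<and> val g {} = 1 \<and>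
      val g {a} = 2 ^ (\<alpha> + \<gamma> - \<beta> + 1) - 1 \<and> val g {b} = 2 ^ (\<gamma> + 1) - 1 \<and>
      val g {a, b} = 2 ^ (\<alpha> + \<gamma> + 1) - 2 ^ (\<gamma> + 1) - 2 ^ (\<alpha> + \<gamma> - \<beta> + 1) + 1)"
  (is "?L \<longleftrightarrow> ?R")
proof
  assume ?L
  then obtain \<phi> where \<phi>: "bij_betw \<phi> (ground g) {pt_a, pt_b}"
      "\<And>X. X \<subseteq> ground g \<Longrightarrow> val g X = val (f3 \<alpha> \<beta> \<gamma>) (\<phi> ` X)"
    by (auto simp: isomorphic_def f3_def)
  obtain a b where ab: "a \<in> ground g" "b \<in> ground g" "\<phi> a = pt_a" "\<phi> b = pt_b"
    using \<phi>(1) unfolding bij_betw_def by (metis imageE insertI1 insertI2)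
  have "ground g \<subseteq> {a, b}"
  proof
    fix x assume x: "x \<in> ground g"
    have "\<phi> x \<in> {pt_a, pt_b}"
      using bij_betwE[OF \<phi>(1)] x by blast
    then show "x \<in> {a, b}"
      using ab x bij_betw_imp_inj_on[OF \<phi>(1)] by (metis insert_iff inj_on_def singletonD)
  qed
  then have "ground g = {a, b}" "a \<noteq> b"
    using ab by auto
  moreover from this have "val g {} = 1"
      "val g {a} = 2 ^ (\<alpha> + \<gamma> - \<beta> + 1) - 1" "val g {b} = 2 ^ (\<gamma> + 1) - 1"
      "val g {a, b} = 2 ^ (\<alpha> + \<gamma> + 1) - 2 ^ (\<gamma> + 1) - 2 ^ (\<alpha> + \<gamma> - \<beta> + 1) + 1"
    using \<phi>(2)[of "{}"] \<phi>(2)[of "{a}"] \<phi>(2)[of "{b}"] \<phi>(2)[of "{a, b}"] ab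
    by (auto simp: f3_def)
  ultimately show ?R
    by blast
next
  assume ?R
  then obtain a b where ab: "a \<noteq> b" "ground g = {a, b}" "val g {} = 1"
      "val g {a} = 2 ^ (\<alpha> + \<gamma> - \<beta> + 1) - 1" "val g {b} = 2 ^ (\<gamma> + 1) - 1"
      "val g {a, b} = 2 ^ (\<alpha> + \<gamma> + 1) - 2 ^ (\<gamma> + 1) - 2 ^ (\<alpha> + \<gamma> - \<beta> + 1) + 1"
    by blast
  define \<phi> where "\<phi> x = (if x = a then pt_a else pt_b)" for x
  have "bij_betw \<phi> (ground g) (ground (f3 \<alpha> \<beta> \<gamma>))"
    using ab(1,2) by (auto simp: bij_betw_def \<phi>_def f3_def inj_on_def)
  moreover have "val g X = val (f3 \<alpha> \<beta> \<gamma>) (\<phi> ` X)" if "X \<subseteq> ground g" for X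
  proof -
    have "X = {} \<or> X = {a} \<or> X = {b} \<or> X = {a, b}"
      using that ab(2) by auto
    then show ?thesis
      using ab by (elim disjE) (auto simp: \<phi>_def f3_def)
  qed
  ultimately show ?L
    unfolding isomorphic_def by blast
qed

text \<open>The minor on \<open>{e}\<close> with \<open>A\<close> deleted has as value the ratio of
  the two subset sums minus 1, so \<open>\<alpha> + 1\<close> is that ratio.\<close>

lemma ex_minor_f1_iff:
  assumes "binary_function f"
  shows "(\<exists>g. is_minor g f \<and> isomorphic g (f1 \<alpha>)) \<longleftrightarrow>
    (\<exists>A e. insert e A \<subseteq> ground f \<and> e \<notin> A \<and> subset_sum f A \<noteq> 0 \<and>
      subset_sum f (insert e A) = (\<alpha> + 1) * subset_sum f A)"
  (is "?L \<longleftrightarrow> ?R")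
proof
  assume ?L
  then obtain G Y e where GY: "G \<subseteq> ground f" "Y \<subseteq> ground f" "G \<inter> Y = {}" "subset_sum f Y \<noteq> 0"
      "ground (deletion (contraction f (ground f - G - Y)) Y) = {e}"
      "val (deletion (contraction f (ground f - G - Y)) Y) {e} = \<alpha>"
    unfolding ex_minor_iff isomorphic_f1_iff by blast
  then have G: "G = {e}"
    using ground_minor by blast
  then have e: "insert e Y \<subseteq> ground f" "e \<notin> Y"
    using GY by auto
  have "\<alpha> + 1 = subset_sum f (insert e Y) / subset_sum f Y"
    using val_minor_singleton[OF assms GY(2,4) e(2)] GY(6) by simp
  then have "subset_sum f (insert e Y) = (\<alpha> + 1) * subset_sum f Y"
    using GY(4) by simp
  then show ?R
    using GY(4) e by blast
next
  assume ?R
  then obtain A e where A: "insert e A \<subseteq> ground f" "e \<notin> A" "subset_sum f A \<noteq> 0"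
      "subset_sum f (insert e A) = (\<alpha> + 1) * subset_sum f A"
    by blast
  let ?g = "deletion (contraction f (ground f - {e} - A)) A"
  have sub: "A \<subseteq> ground f" "{e} \<subseteq> ground f" "{e} \<inter> A = {}"
    using A(1,2) by auto
  have "ground ?g = {e}" "val ?g {} = 1"
    using ground_minor[OF sub(2,3)] val_minor_empty[OF assms sub(1) A(3)] .
  moreover have "val ?g {e} = \<alpha>"
    using val_minor_singleton[OF assms sub(1) A(3,2)] A(3,4) by simp
  ultimately show ?L
    unfolding ex_minor_iff isomorphic_f1_iff using sub A(3) by blast
qed

text \<open>The values of \<open>f3\<close> are chosen so that its own subset sums at
  \<open>{pt_a}\<close>, \<open>{pt_b}\<close> and \<open>{pt_a, pt_b}\<close> are the three powers
  of two below. Those of a minor are the subset sums of \<open>f\<close> divided by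
  \<open>subset_sum f A\<close>.\<close>

lemma ex_minor_f3_iff:
  assumes "binary_function f"
  shows "(\<exists>g. is_minor g f \<and> isomorphic g (f3 \<alpha> \<beta> \<gamma>)) \<longleftrightarrow>
    (\<exists>A a b. insert a (insert b A) \<subseteq> ground f \<and> a \<notin> A \<and> b \<notin> A \<and> a \<noteq> b \<and>
      subset_sum f A \<noteq> 0 \<and>
      subset_sum f (insert a A) = 2 ^ (\<alpha> + \<gamma> - \<beta> + 1) * subset_sum f A \<and>
      subset_sum f (insert b A) = 2 ^ (\<gamma> + 1) * subset_sum f A \<and>
      subset_sum f (insert a (insert b A)) = 2 ^ (\<alpha> + \<gamma> + 1) * subset_sum f A)"
  (is "?L \<longleftrightarrow> ?R")
proof
  assume ?L
  then obtain G Y a b where GY: "G \<subseteq> ground f" "Y \<subseteq> ground f" "G \<inter> Y = {}" "subset_sum f Y \<noteq> 0"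
      "ground (deletion (contraction f (ground f - G - Y)) Y) = {a, b}" "a \<noteq> b"
      "val (deletion (contraction f (ground f - G - Y)) Y) {a} = 2 ^ (\<alpha> + \<gamma> - \<beta> + 1) - 1"
      "val (deletion (contraction f (ground f - G - Y)) Y) {b} = 2 ^ (\<gamma> + 1) - 1"
      "val (deletion (contraction f (ground f - G - Y)) Y) {a, b} =
        2 ^ (\<alpha> + \<gamma> + 1) - 2 ^ (\<gamma> + 1) - 2 ^ (\<alpha> + \<gamma> - \<beta> + 1) + 1"
    unfolding ex_minor_iff isomorphic_f3_iff by blast
  have "G = {a, b}"
    using GY ground_minor by blast
  then have ab: "a \<notin> Y" "b \<notin> Y" "insert a (insert b Y) \<subseteq> ground f"
    using GY by auto
  have Sa: "subset_sum f (insert a Y) = 2 ^ (\<alpha> + \<gamma> - \<beta> + 1) * subset_sum f Y"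
  proof -
    have "subset_sum f (insert a Y) / subset_sum f Y = 2 ^ (\<alpha> + \<gamma> - \<beta> + 1)"
      using val_minor_singleton[OF assms GY(2,4) ab(1)] GY(7) by simp
    then show ?thesis
      using GY(4) by (simp only: nonzero_divide_eq_eq not_False_eq_True)
  qed
  have Sb: "subset_sum f (insert b Y) = 2 ^ (\<gamma> + 1) * subset_sum f Y"
  proof -
    have "subset_sum f (insert b Y) / subset_sum f Y = 2 ^ (\<gamma> + 1)"
      using val_minor_singleton[OF assms GY(2,4) ab(2)] GY(8) by simp
    then show ?thesis
      using GY(4) by (simp only: nonzero_divide_eq_eq not_False_eq_True)
  qed
  have "(subset_sum f (insert a (insert b Y)) - subset_sum f (insert a Y)
      - subset_sum f (insert b Y)) / subset_sum f Y =
      2 ^ (\<alpha> + \<gamma> + 1) - 2 ^ (\<gamma> + 1) - 2 ^ (\<alpha> + \<gamma> - \<beta> + 1)"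
    using val_minor_pair[OF assms GY(2,4) ab(1,2) GY(6)] GY(9) by simp
  then have "subset_sum f (insert a (insert b Y)) - subset_sum f (insert a Y)
      - subset_sum f (insert b Y) =
      (2 ^ (\<alpha> + \<gamma> + 1) - 2 ^ (\<gamma> + 1) - 2 ^ (\<alpha> + \<gamma> - \<beta> + 1)) * subset_sum f Y"
    using GY(4) by (simp only: nonzero_divide_eq_eq not_False_eq_True)
  then have "subset_sum f (insert a (insert b Y)) = 2 ^ (\<alpha> + \<gamma> + 1) * subset_sum f Y"
    unfolding Sa Sb by (simp add: algebra_simps)
  then show ?R
    using GY(4,6) ab Sa Sb by blast
next
  assume ?R
  then obtain A a b where A: "insert a (insert b A) \<subseteq> ground f" "a \<notin> A" "b \<notin> A" "a \<noteq> b"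
      "subset_sum f A \<noteq> 0"
      "subset_sum f (insert a A) = 2 ^ (\<alpha> + \<gamma> - \<beta> + 1) * subset_sum f A"
      "subset_sum f (insert b A) = 2 ^ (\<gamma> + 1) * subset_sum f A"
      "subset_sum f (insert a (insert b A)) = 2 ^ (\<alpha> + \<gamma> + 1) * subset_sum f A"
    by blast
  let ?g = "deletion (contraction f (ground f - {a, b} - A)) A"
  have sub: "A \<subseteq> ground f" "{a, b} \<subseteq> ground f" "{a, b} \<inter> A = {}"
    using A(1-3) by auto
  have "(subset_sum f (insert a (insert b A)) - subset_sum f (insert a A)
      - subset_sum f (insert b A)) / subset_sum f A =
      2 ^ (\<alpha> + \<gamma> + 1) - 2 ^ (\<gamma> + 1) - 2 ^ (\<alpha> + \<gamma> - \<beta> + 1)"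
    unfolding A(6-8) using A(5) by (simp add: diff_divide_distrib)
  then have "val ?g {a, b} =
      2 ^ (\<alpha> + \<gamma> + 1) - 2 ^ (\<gamma> + 1) - 2 ^ (\<alpha> + \<gamma> - \<beta> + 1) + 1"
    using val_minor_pair[OF assms sub(1) A(5,2,3,4)] by simp
  moreover have "ground ?g = {a, b}" "val ?g {} = 1"
    using ground_minor[OF sub(2,3)] val_minor_empty[OF assms sub(1) A(5)] .
  moreover have "val ?g {a} = 2 ^ (\<alpha> + \<gamma> - \<beta> + 1) - 1"
    using val_minor_singleton[OF assms sub(1) A(5,2)] A(5,6) by simp
  moreover have "val ?g {b} = 2 ^ (\<gamma> + 1) - 1"
    using val_minor_singleton[OF assms sub(1) A(5,3)] A(5,7) by simp
  ultimately show ?L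
    unfolding ex_minor_iff isomorphic_f3_iff using sub A(4,5) by blast
qed

section \<open>Excluded minors as conditions on the exponents\<close>

text \<open>The exclusion forces each one-step ratio of subset sums to be \<open>2 ^ n\<close> with
  \<open>n \<le> k\<close>, and multiplying these ratios up from the empty set yields the exponents.
  Conversely, an increment \<open>n\<close> of \<open>r\<close> produces the one-element minor with
  the permitted value \<open>2 ^ n - 1\<close>.\<close>

lemma no_minor_f1_iff:
  assumes "binary_function f"
  shows "\<not> (\<exists>g \<alpha>. is_minor g f \<and> \<alpha> \<notin> {2 ^ n - 1 | n :: nat. n \<le> k} \<and> isomorphic g (f1 \<alpha>)) \<longleftrightarrow>
    (\<exists>r. exponent_function k f r)"
  (is "?L \<longleftrightarrow> ?R")
proof
  assume L: ?L
  have step: "\<exists>n\<le>k. subset_sum f (insert e A) = 2 ^ n * subset_sum f A"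
    if A: "insert e A \<subseteq> ground f" "e \<notin> A" "subset_sum f A \<noteq> 0" for A e
  proof -
    define \<alpha> where "\<alpha> = subset_sum f (insert e A) / subset_sum f A - 1"
    have "subset_sum f (insert e A) = (\<alpha> + 1) * subset_sum f A"
      using A(3) by (simp add: \<alpha>_def)
    then have "\<exists>g. is_minor g f \<and> isomorphic g (f1 \<alpha>)"
      using A ex_minor_f1_iff[OF assms] by blast
    then have "\<alpha> \<in> {2 ^ n - 1 | n :: nat. n \<le> k}"
      using L by blast
    then obtain n where "n \<le> k" "\<alpha> = 2 ^ n - 1"
      by blast
    then show ?thesis
      using A(3) by (intro exI[of _ n]) (simp add: \<alpha>_def field_simps)
  qed
  \<comment> \<open>A minor deleting \<open>A\<close> exists only if the sum at \<open>A\<close> is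
    nonzero. The induction supplies this: it starts from the sum 1, and every sum reached is a power
    of two.\<close>
  have pow: "\<exists>n::nat. subset_sum f A = 2 ^ n" if "A \<subseteq> ground f" for A
  proof -
    have "finite A"
      using that assms by (auto simp: binary_function_def intro: finite_subset)
    then show ?thesis
      using that
    proof (induction A rule: finite_induct)
      case empty
      show ?case
        using subset_sum_empty[OF assms] by (intro exI[of _ 0]) simp
    next
      case (insert e A)
      then obtain n :: nat where n: "subset_sum f A = 2 ^ n"
        by auto
      then obtain m where "subset_sum f (insert e A) = 2 ^ m * subset_sum f A"
        using step[of e A] insert by auto
      then show ?case
        using n by (intro exI[of _ "m + n"]) (simp add: power_add)
    qed
  qed
  define r where "r A = (SOME n::nat. subset_sum f A = 2 ^ n)" for A
  have r: "subset_sum f A = 2 ^ r A" if "A \<subseteq> ground f" for A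
    unfolding r_def using someI_ex[OF pow[OF that]] .
  have "r A \<le> r (insert e A) \<and> r (insert e A) \<le> r A + k"
    if A: "insert e A \<subseteq> ground f" "e \<notin> A" for A e
  proof -
    have rA: "subset_sum f A = 2 ^ r A"
      using r A by blast
    then obtain n where n: "n \<le> k" "subset_sum f (insert e A) = 2 ^ n * subset_sum f A"
      using step[of e A] A by auto
    have "(2::real) ^ r (insert e A) = 2 ^ (n + r A)"
      using n(2) r[OF A(1)] rA by (simp add: power_add)
    then have "r (insert e A) = n + r A"
      by simp
    then show ?thesis
      using n(1) by simp
  qed
  then have "exponent_function k f r"
    using r by (simp add: exponent_function_def)
  then show ?R by blast
next
  assume ?R
  then obtain r where r: "\<And>A. A \<subseteq> ground f \<Longrightarrow> subset_sum f A = 2 ^ r A"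
      "\<And>A e. insert e A \<subseteq> ground f \<Longrightarrow> e \<notin> A \<Longrightarrow> r A \<le> r (insert e A) \<and> r (insert e A) \<le> r A + k"
    unfolding exponent_function_def by blast
  show ?L
  proof
    assume "\<exists>g \<alpha>. is_minor g f \<and> \<alpha> \<notin> {2 ^ n - 1 | n :: nat. n \<le> k} \<and> isomorphic g (f1 \<alpha>)"
    then obtain \<alpha> A e where A: "\<alpha> \<notin> {2 ^ n - 1 | n :: nat. n \<le> k}" "insert e A \<subseteq> ground f" "e \<notin> A"
        "subset_sum f (insert e A) = (\<alpha> + 1) * subset_sum f A"
      using ex_minor_f1_iff[OF assms] by blast
    obtain n where n: "r (insert e A) = r A + n" "n \<le> k"
      using r(2)[OF A(2,3)] by (metis add_le_cancel_left le_Suc_ex)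
    have "\<alpha> = 2 ^ n - 1"
      using A(2,4) r(1)[of A] r(1)[of "insert e A"] n(1) by (simp add: power_add)
    then show False
      using A(1) n(2) by blast
  qed
qed

text \<open>At a minor \<open>f3\<close> the exponents exceed \<open>r A\<close> by
  \<open>\<alpha> + \<gamma> - \<beta> + 1\<close>, \<open>\<gamma> + 1\<close> and
  \<open>\<alpha> + \<gamma> + 1\<close>, so supermodularity fails by exactly
  \<open>\<gamma> - \<beta> + 1 > 0\<close>. Conversely, every failure has this form once
  \<open>a\<close> and \<open>b\<close> are suitably ordered.\<close>

lemma no_minor_f3_iff:
  assumes "binary_function f" and ef: "exponent_function k f r"
  shows "\<not> (\<exists>g \<alpha> \<beta> \<gamma>. is_minor g f \<and> \<alpha> \<le> \<beta> \<and> \<beta> \<le> \<gamma> \<and> \<gamma> \<le> k - 1 \<and> isomorphic g (f3 \<alpha> \<beta> \<gamma>)) \<longleftrightarrow>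
    locally_supermodular (ground f) r"
  (is "\<not> ?M \<longleftrightarrow> ?S")
proof -
  have r: "\<And>A. A \<subseteq> ground f \<Longrightarrow> subset_sum f A = 2 ^ r A"
    and inc: "\<And>A e. insert e A \<subseteq> ground f \<Longrightarrow> e \<notin> A \<Longrightarrow>
      r A \<le> r (insert e A) \<and> r (insert e A) \<le> r A + k"
    using ef unfolding exponent_function_def by blast+
  have ratio: "subset_sum f B = 2 ^ n * subset_sum f A \<longleftrightarrow> r B = n + r A"
    if "A \<subseteq> ground f" "B \<subseteq> ground f" for A B n
  proof -
    have "subset_sum f B = 2 ^ n * subset_sum f A \<longleftrightarrow> (2::real) ^ r B = 2 ^ (n + r A)"
      using r that by (simp add: power_add)
    then show ?thesis by simp
  qed
  have "?M" if nS: "\<not> ?S"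
  proof -
    \<comment> \<open>The failure is symmetric in \<open>a\<close> and \<open>b\<close>, so the one
      with the smaller exponent can be called \<open>a\<close>.\<close>
    obtain A a b where A: "insert a (insert b A) \<subseteq> ground f" "a \<notin> A" "b \<notin> A" "a \<noteq> b"
        "r A + r (insert a (insert b A)) < r (insert a A) + r (insert b A)"
        "r (insert a A) \<le> r (insert b A)"
    proof -
      obtain A a b where A: "insert a (insert b A) \<subseteq> ground f" "a \<notin> A" "b \<notin> A" "a \<noteq> b"
        "r A + r (insert a (insert b A)) < r (insert a A) + r (insert b A)"
        using nS unfolding locally_supermodular_def by (meson not_le)
      show ?thesis
      proof (cases "r (insert a A) \<le> r (insert b A)")
        case True
        then show ?thesis using that[of a b A] A by blast
      next
        case False
        then show ?thesis
          using that[of b a A] A by (simp add: insert_commute add.commute)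
      qed
    qed
    have sub: "A \<subseteq> ground f" "insert a A \<subseteq> ground f" "insert b A \<subseteq> ground f"
      using A(1) by auto
    have inc_a: "r A \<le> r (insert a A)" "r (insert b A) \<le> r (insert a (insert b A))"
      using inc[OF sub(2) A(2)] inc[of a "insert b A"] A(1,2,4) by auto
    have inc_b: "r A \<le> r (insert b A)" "r (insert b A) \<le> r A + k"
      using inc[OF sub(3) A(3)] by auto
    text \<open>The exponents of the minor are solved for from its three ranks.\<close>
    define \<alpha> where "\<alpha> = r (insert a (insert b A)) - r (insert b A)"
    define \<beta> where "\<beta> = r (insert a (insert b A)) - r (insert a A)"
    define \<gamma> where "\<gamma> = r (insert b A) - r A - 1"
    \<comment> \<open>In turn: the ordering of \<open>a\<close> and \<open>b\<close>, the strict
      failure of supermodularity, and the increment bound at \<open>b\<close>. The failure, the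
      ordering and monotonicity give \<open>r A < r (insert b A)\<close>, so the subtraction of 1 in
      \<open>\<gamma>\<close> does not truncate.\<close>
    have "\<alpha> \<le> \<beta>" "\<beta> \<le> \<gamma>" "\<gamma> \<le> k - 1"
      using A(5,6) inc_a inc_b by (auto simp: \<alpha>_def \<beta>_def \<gamma>_def)
    moreover have "r (insert a A) = (\<alpha> + \<gamma> - \<beta> + 1) + r A" "r (insert b A) = (\<gamma> + 1) + r A"
        "r (insert a (insert b A)) = (\<alpha> + \<gamma> + 1) + r A"
      using A(5,6) inc_a inc_b by (auto simp: \<alpha>_def \<beta>_def \<gamma>_def)
    then have "subset_sum f (insert a A) = 2 ^ (\<alpha> + \<gamma> - \<beta> + 1) * subset_sum f A"
        "subset_sum f (insert b A) = 2 ^ (\<gamma> + 1) * subset_sum f A"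
        "subset_sum f (insert a (insert b A)) = 2 ^ (\<alpha> + \<gamma> + 1) * subset_sum f A"
      using ratio sub A(1) by blast+
    then have "\<exists>g. is_minor g f \<and> isomorphic g (f3 \<alpha> \<beta> \<gamma>)"
      unfolding ex_minor_f3_iff[OF assms(1)] using A(1-4) r[OF sub(1)]
      by (metis power_not_zero zero_neq_numeral)
    ultimately show ?M by blast
  qed
  moreover have "\<not> ?S" if M: ?M
  proof -
    obtain \<alpha> \<beta> \<gamma> where le: "\<alpha> \<le> \<beta>" "\<beta> \<le> \<gamma>" and ex: "\<exists>g. is_minor g f \<and> isomorphic g (f3 \<alpha> \<beta> \<gamma>)"
      using M by blast
    obtain A a b where A: "insert a (insert b A) \<subseteq> ground f" "a \<notin> A" "b \<notin> A" "a \<noteq> b"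
        "subset_sum f (insert a A) = 2 ^ (\<alpha> + \<gamma> - \<beta> + 1) * subset_sum f A"
        "subset_sum f (insert b A) = 2 ^ (\<gamma> + 1) * subset_sum f A"
        "subset_sum f (insert a (insert b A)) = 2 ^ (\<alpha> + \<gamma> + 1) * subset_sum f A"
      using ex unfolding ex_minor_f3_iff[OF assms(1)] by blast
    have "A \<subseteq> ground f" "insert a A \<subseteq> ground f" "insert b A \<subseteq> ground f"
      using A(1) by auto
    then have "r (insert a A) = (\<alpha> + \<gamma> - \<beta> + 1) + r A" "r (insert b A) = (\<gamma> + 1) + r A"
        "r (insert a (insert b A)) = (\<alpha> + \<gamma> + 1) + r A"
      using A(1,5-7) ratio by blast+
    then have "r A + r (insert a (insert b A)) < r (insert a A) + r (insert b A)"
      using le by simp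
    then show ?thesis
      using A(1-4) unfolding locally_supermodular_def by (meson not_le)
  qed
  ultimately show ?thesis by blast
qed

section \<open>From exponents to the rank function and back\<close>

text \<open>One-element increments are added up along \<open>B\<close>. With \<open>A\<close> the
  complement of \<open>X\<close> and \<open>B = X\<close> this gives nonnegativity in (R0) and the
  bound (R1).\<close>

lemma exponent_function_Un_bounds:
  assumes "exponent_function k f r" "finite B" "A \<union> B \<subseteq> ground f" "A \<inter> B = {}"
  shows "r A \<le> r (A \<union> B) \<and> r (A \<union> B) \<le> r A + k * card B"
  using assms(2-4)
proof (induction B rule: finite_induct)
  case (insert e B)
  have "r (A \<union> B) \<le> r (insert e (A \<union> B)) \<and> r (insert e (A \<union> B)) \<le> r (A \<union> B) + k"
    using assms(1) insert unfolding exponent_function_def by auto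
  then show ?case
    using insert by auto
qed simp

lemma Q_eq_exponent_diff:
  assumes "exponent_function k f r"
  shows "Q f X = real (r (ground f)) - real (r (ground f - X))"
proof -
  have "rank_quotient f X = 2 ^ r (ground f) / 2 ^ r (ground f - X)"
    using assms by (simp add: rank_quotient_def exponent_function_def flip: subset_sum_def)
  then show ?thesis
    by (simp add: Q_def log_divide log_nat_power)
qed

text \<open>Passing to complements reverses inclusion and the minus sign in \<open>Q\<close>
  reverses order, so monotonicity survives while supermodularity of \<open>r\<close> becomes
  (R3).\<close>

lemma polymatroidal_if_exponent_function:
  assumes "binary_function f" and ef: "exponent_function k f r"
    and sm: "locally_supermodular (ground f) r"
  shows "polymatroidal k f"
proof -
  let ?E = "ground f"
  have fin: "finite ?E"
    using assms(1) by (simp add: binary_function_def)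
  have r: "\<And>A. A \<subseteq> ?E \<Longrightarrow> subset_sum f A = 2 ^ r A"
    and inc: "\<And>A e. insert e A \<subseteq> ?E \<Longrightarrow> e \<notin> A \<Longrightarrow>
      r A \<le> r (insert e A) \<and> r (insert e A) \<le> r A + k"
    using ef unfolding exponent_function_def by blast+
  have bounds: "r (?E - X) \<le> r ?E \<and> r ?E \<le> r (?E - X) + k * card X" if "X \<subseteq> ?E" for X
  proof -
    have "?E - X \<union> X = ?E"
      using that by blast
    then show ?thesis
      using exponent_function_Un_bounds[OF ef, of X "?E - X"] that fin finite_subset by auto
  qed
  have "rankable f"
    by (simp add: rankable_def rank_quotient_def r flip: subset_sum_def)
  moreover have "Q f X \<in> \<nat> \<and> Q f X \<le> real k * real (card X)" if "X \<subseteq> ?E" for X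
  proof -
    have "Q f X = real (r ?E - r (?E - X))"
      using bounds[OF that] by (simp add: Q_eq_exponent_diff[OF ef] of_nat_diff)
    moreover have "r ?E - r (?E - X) \<le> k * card X"
      using bounds[OF that] by linarith
    ultimately show ?thesis
      by (metis of_nat_in_Nats of_nat_le_iff of_nat_mult)
  qed
  moreover have "Q f X \<le> Q f (X \<union> {e})" if "X \<subseteq> ?E" "e \<in> ?E - X" for X e
  proof -
    have "insert e (?E - (X \<union> {e})) = ?E - X"
      using that by blast
    then show ?thesis
      using inc[of e "?E - (X \<union> {e})"] by (auto simp: Q_eq_exponent_diff[OF ef])
  qed
  moreover have "Q f X + Q f (X \<union> {a, b}) \<le> Q f (X \<union> {a}) + Q f (X \<union> {b})"
    if "X \<subseteq> ?E" "a \<in> ?E - X" "b \<in> ?E - X" "a \<noteq> b" for X a b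
  proof -
    let ?A = "?E - (X \<union> {a, b})"
    \<comment> \<open>Complementation swaps the roles of \<open>a\<close> and \<open>b\<close>:
      adding \<open>a\<close> to \<open>?A\<close> leaves only \<open>b\<close> to be removed along
      with \<open>X\<close>.\<close>
    have eqs: "insert a ?A = ?E - (X \<union> {b})" "insert b ?A = ?E - (X \<union> {a})"
        "insert a (?E - (X \<union> {a})) = ?E - X"
      using that by blast+
    have "r (insert a ?A) + r (insert b ?A) \<le> r ?A + r (insert a (insert b ?A))"
      using sm[unfolded locally_supermodular_def, rule_format, of a b ?A] that by blast
    then show ?thesis
      unfolding eqs Q_eq_exponent_diff[OF ef] by linarith
  qed
  ultimately show ?thesis
    by (simp add: polymatroidal_def)
qed

text \<open>The formula for \<open>Q\<close> is inverted: \<open>r A = Q f E - Q f (E - A)\<close>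
  with \<open>E\<close> the ground set. Since the sum at \<open>{}\<close> is 1, the sum at
  \<open>E\<close> is \<open>2 powr Q f E\<close>, and dividing by \<open>2 powr Q f (E - A)\<close>
  gives the sum at \<open>A\<close>.\<close>

lemma exponent_function_if_polymatroidal:
  assumes "binary_function f" "polymatroidal k f"
  shows "\<exists>r. exponent_function k f r \<and> locally_supermodular (ground f) r"
proof -
  let ?E = "ground f"
  have fin: "finite ?E"
    using assms(1) by (simp add: binary_function_def)
  have rk: "\<And>X. X \<subseteq> ?E \<Longrightarrow> subset_sum f (?E - X) \<noteq> 0 \<and> rank_quotient f X > 0"
    and R0: "\<And>X. X \<subseteq> ?E \<Longrightarrow> Q f X \<in> \<nat>"
    and R1: "\<And>X. X \<subseteq> ?E \<Longrightarrow> Q f X \<le> real k * real (card X)"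
    and R2: "\<And>X e. X \<subseteq> ?E \<Longrightarrow> e \<in> ?E - X \<Longrightarrow> Q f X \<le> Q f (X \<union> {e})"
    and R3: "\<And>X a b. X \<subseteq> ?E \<Longrightarrow> a \<in> ?E - X \<Longrightarrow> b \<in> ?E - X \<Longrightarrow> a \<noteq> b \<Longrightarrow>
        Q f X + Q f (X \<union> {a, b}) \<le> Q f (X \<union> {a}) + Q f (X \<union> {b})"
    using assms(2) by (simp_all add: polymatroidal_def rankable_def subset_sum_def)
  have quot: "rank_quotient f X = subset_sum f ?E / subset_sum f (?E - X)" for X
    by (simp add: rank_quotient_def subset_sum_def)
  \<comment> \<open>The rank quotient of the whole ground set has denominator 1, so rankability
    makes the full sum positive.\<close>
  have SE: "subset_sum f ?E > 0"
    using rk[of ?E] quot[of ?E] subset_sum_empty[OF assms(1)] by simp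
  have Q0: "Q f {} = 0"
    using SE by (simp add: Q_def quot)
  have Q_pow: "2 powr Q f X = subset_sum f ?E / subset_sum f (?E - X)" if "X \<subseteq> ?E" for X
    using rk[OF that] by (simp add: Q_def quot)
  \<comment> \<open>(R1) bounds ranks, not increments. By (R3) the gain from \<open>e\<close> can
    only grow when elements are removed from \<open>X\<close>, so it is at most
    \<open>Q f {e}\<close>.\<close>
  have marginal: "Q f (insert e X) - Q f X \<le> k" if "insert e X \<subseteq> ?E" "e \<notin> X" for X e
  proof -
    have "finite X"
      using that fin by (auto intro: finite_subset)
    then have "Q f (insert e X) - Q f X \<le> Q f {e}"
      using that
    proof (induction X rule: finite_induct)
      case empty
      then show ?case by (simp add: Q0)
    next
      case (insert x X)
      then show ?case
        using R3[of X e x] by auto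
    qed
    then show ?thesis
      using R1[of "{e}"] that by simp
  qed
  \<comment> \<open>Iterating (R2) up to the ground set ensures that the difference defining
    \<open>r\<close> is nonnegative.\<close>
  have mono: "Q f X \<le> Q f ?E" if "X \<subseteq> ?E" for X
  proof -
    have "X \<union> B \<subseteq> ?E \<Longrightarrow> X \<inter> B = {} \<Longrightarrow> Q f X \<le> Q f (X \<union> B)" if "finite B" for B
      using that
    proof (induction B rule: finite_induct)
      case (insert e B)
      then show ?case
        using R2[of "X \<union> B" e] by auto
    qed simp
    from this[of "?E - X"] show ?thesis
      using that fin by (simp add: Un_absorb1)
  qed
  \<comment> \<open>Rounding is only a change of type: the difference is already a natural number by
    (R0) and \<open>mono\<close>, as \<open>real_r\<close> records.\<close>
  define r where "r A = nat \<lfloor>Q f ?E - Q f (?E - A)\<rfloor>" for A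
  have real_r: "real (r A) = Q f ?E - Q f (?E - A)" for A
  proof -
    obtain m n where "Q f ?E = real m" "Q f (?E - A) = real n"
      using R0[of ?E] R0[of "?E - A"] by (auto elim!: Nats_cases)
    moreover have "n \<le> m"
      using mono[of "?E - A"] calculation by simp
    ultimately show ?thesis
      by (simp add: r_def)
  qed
  have "subset_sum f A = 2 ^ r A" if "A \<subseteq> ?E" for A
  proof -
    have "?E - (?E - A) = A"
      using that by blast
    moreover have "2 powr real (r A) = 2 powr Q f ?E / 2 powr Q f (?E - A)"
      unfolding real_r by (simp add: powr_diff)
    ultimately have "2 powr real (r A) = subset_sum f A"
      using Q_pow[of ?E] Q_pow[of "?E - A"] SE subset_sum_empty[OF assms(1)] by simp
    then show ?thesis
      by (simp add: powr_realpow)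
  qed
  moreover have "r A \<le> r (insert e A) \<and> r (insert e A) \<le> r A + k"
    if "insert e A \<subseteq> ?E" "e \<notin> A" for A e
  proof -
    let ?X = "?E - insert e A"
    have eq: "insert e ?X = ?E - A"
      using that by blast
    have "Q f ?X \<le> Q f (?E - A)" "Q f (?E - A) - Q f ?X \<le> k"
      using R2[of ?X e] marginal[of e ?X] that eq by auto
    then have "real (r A) \<le> real (r (insert e A))" "real (r (insert e A)) \<le> real (r A) + real k"
      unfolding real_r by simp_all
    then show ?thesis by linarith
  qed
  moreover have "r (insert a A) + r (insert b A) \<le> r A + r (insert a (insert b A))"
    if "insert a (insert b A) \<subseteq> ?E" "a \<notin> A" "b \<notin> A" "a \<noteq> b" for A a b
  proof -
    let ?X = "?E - insert a (insert b A)"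
    have "?X \<union> {a} = ?E - insert b A" "?X \<union> {b} = ?E - insert a A" "?X \<union> {a, b} = ?E - A"
      using that by blast+
    then have "Q f ?X + Q f (?E - A) \<le> Q f (?E - insert b A) + Q f (?E - insert a A)"
      using R3[of ?X a b] that by simp
    then have "real (r (insert a A)) + real (r (insert b A)) \<le>
        real (r A) + real (r (insert a (insert b A)))"
      unfolding real_r by simp
    then show ?thesis by linarith
  qed
  ultimately have "exponent_function k f r" "locally_supermodular ?E r"
    by (simp_all add: exponent_function_def locally_supermodular_def)
  then show ?thesis
    by blast
qed

theorem theorem11:
  fixes k :: nat and f :: "'a setfun"
  assumes "k > 0" and "binary_function f"
  shows "polymatroidal k f \<longleftrightarrow>
    \<not> (\<exists>g. is_minor g f \<and>
        ((\<exists>\<alpha>::real. \<alpha> \<notin> {2 ^ n - 1 | n :: nat. n \<le> k} \<and> isomorphic g (f1 \<alpha>)) \<or>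
         (\<exists>\<alpha> \<beta> \<gamma> :: nat. \<alpha> \<le> \<beta> \<and> \<beta> \<le> \<gamma> \<and> \<gamma> \<le> k - 1 \<and> isomorphic g (f3 \<alpha> \<beta> \<gamma>))))"
  (is "_ \<longleftrightarrow> \<not> ?M")
proof -
  let ?M1 = "\<exists>g \<alpha>. is_minor g f \<and> \<alpha> \<notin> {2 ^ n - 1 | n :: nat. n \<le> k} \<and> isomorphic g (f1 \<alpha>)"
  let ?M2 = "\<exists>g \<alpha> \<beta> \<gamma>. is_minor g f \<and> \<alpha> \<le> \<beta> \<and> \<beta> \<le> \<gamma> \<and> \<gamma> \<le> k - 1 \<and> isomorphic g (f3 \<alpha> \<beta> \<gamma>)"
  have "polymatroidal k f \<longleftrightarrow> (\<exists>r. exponent_function k f r \<and> locally_supermodular (ground f) r)"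
    using polymatroidal_if_exponent_function exponent_function_if_polymatroidal assms(2) by blast
  \<comment> \<open>The condition \<open>?M2\<close> does not mention \<open>r\<close>, and its
    equivalence with failure of supermodularity holds for every exponent function, so it can leave
    the quantifier.\<close>
  also have "\<dots> \<longleftrightarrow> (\<exists>r. exponent_function k f r) \<and> \<not> ?M2"
    using no_minor_f3_iff[OF assms(2)] by blast
  also have "\<dots> \<longleftrightarrow> \<not> ?M1 \<and> \<not> ?M2"
    using no_minor_f1_iff[OF assms(2)] by simp
  also have "\<dots> \<longleftrightarrow> \<not> ?M"
    by blast
  finally show ?thesis .
qed

end
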